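(* For a weakly modular graph $G$ the following are equivalent: (i) there exists $\delta$ such that $G$ is $\delta$--hyperbolic; (ii) there exist $\mu,\kappa$ such that all metric triangles of $G$ have sides of length at most $\mu$ and $G$ does not contain isometric square grids of side $\kappa$.
   Context: Graphs are simple, undirected, connected, possibly infinite; $d$ graph distance, $I(u,v)=\{x:d(u,x)+d(x,v)=d(u,v)\}$. Weakly modular: for every vertex $u$, (TC) for $v,w$ with $1=d(v,w)<d(u,v)=d(u,w)$ there is a common neighbor $x$ of $v,w$ with $d(u,x)=d(u,v)-1$, and (QC) for $v,w,z$ with $d(v,z)=d(w,z)=1$, $2=d(v,w)\le d(u,v)=d(u,w)=d(u,z)-1$ there is a common neighbor $x$ of $v,w$ with $d(u,x)=d(u,v)-1$. $G$ is $\delta$--hyperbolic if for any four vertices $u,v,x,y$ the two largest of the sums $d(u,v)+d(x,y)$, $d(u,x)+d(v,y)$, $d(u,y)+d(v,x)$ differ by at most $2\delta$. Vertices $v_1,v_2,v_3$ form a metric triangle if $I(v_i,v_j)\cap I(v_i,v_k)=\{v_i\}$ for all distinct $i,j,k$; its sides are the distances $d(v_i,v_j)$. A square grid of side $k$ is the Cartesian product of two paths with $k$ edges each ($(k+1)\times(k+1)$ vertices); it is isometric in $G$ if it is a subgraph of $G$ whose distances equal those in $G$. *)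

theory Defs
  imports Complex_Main
begin

text \<open>A graph is given by an edge relation E on the vertex type 'a (all elements of 'a
are vertices; the vertex set may be infinite).\<close>

definition is_graph :: "('a \<Rightarrow> 'a \<Rightarrow> bool) \<Rightarrow> bool" where
  "is_graph E \<longleftrightarrow> (\<forall>x y. E x y \<longrightarrow> E y x) \<and> (\<forall>x. \<not> E x x)"

definition is_walk :: "('a \<Rightarrow> 'a \<Rightarrow> bool) \<Rightarrow> (nat \<Rightarrow> 'a) \<Rightarrow> nat \<Rightarrow> 'a \<Rightarrow> 'a \<Rightarrow> bool" where
  "is_walk E p n u v \<longleftrightarrow> p 0 = u \<and> p n = v \<and> (\<forall>i<n. E (p i) (p (Suc i)))"

definition connected_graph :: "('a \<Rightarrow> 'a \<Rightarrow> bool) \<Rightarrow> bool" where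
  "connected_graph E \<longleftrightarrow> (\<forall>u v. \<exists>p n. is_walk E p n u v)"

definition gdist :: "('a \<Rightarrow> 'a \<Rightarrow> bool) \<Rightarrow> 'a \<Rightarrow> 'a \<Rightarrow> nat" where
  "gdist E u v = (LEAST n. \<exists>p. is_walk E p n u v)"

definition interval :: "('a \<Rightarrow> 'a \<Rightarrow> bool) \<Rightarrow> 'a \<Rightarrow> 'a \<Rightarrow> 'a set" where
  "interval E u v = {x. gdist E u x + gdist E x v = gdist E u v}"

definition triangle_condition :: "('a \<Rightarrow> 'a \<Rightarrow> bool) \<Rightarrow> 'a \<Rightarrow> bool" where
  "triangle_condition E u \<longleftrightarrow>
     (\<forall>v w. gdist E v w = 1 \<and> 1 < gdist E u v \<and> gdist E u v = gdist E u w \<longrightarrow>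
        (\<exists>x. gdist E x v = 1 \<and> gdist E x w = 1 \<and> gdist E u x = gdist E u v - 1))"

definition quadrangle_condition :: "('a \<Rightarrow> 'a \<Rightarrow> bool) \<Rightarrow> 'a \<Rightarrow> bool" where
  "quadrangle_condition E u \<longleftrightarrow>
     (\<forall>v w z. gdist E v z = 1 \<and> gdist E w z = 1 \<and> gdist E v w = 2 \<and>
        2 \<le> gdist E u v \<and> gdist E u v = gdist E u w \<and> gdist E u z = gdist E u v + 1 \<longrightarrow>
        (\<exists>x. gdist E x v = 1 \<and> gdist E x w = 1 \<and> gdist E u x = gdist E u v - 1))"

definition weakly_modular :: "('a \<Rightarrow> 'a \<Rightarrow> bool) \<Rightarrow> bool" where
  "weakly_modular E \<longleftrightarrow> (\<forall>u. triangle_condition E u \<and> quadrangle_condition E u)"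

definition hyperbolic :: "('a \<Rightarrow> 'a \<Rightarrow> bool) \<Rightarrow> real \<Rightarrow> bool" where
  "hyperbolic E \<delta> \<longleftrightarrow> (\<forall>u v x y.
     let s = sort [real (gdist E u v + gdist E x y), real (gdist E u x + gdist E v y),
                   real (gdist E u y + gdist E v x)]
     in s ! 2 - s ! 1 \<le> 2 * \<delta>)"

definition metric_triangle :: "('a \<Rightarrow> 'a \<Rightarrow> bool) \<Rightarrow> 'a \<Rightarrow> 'a \<Rightarrow> 'a \<Rightarrow> bool" where
  "metric_triangle E v1 v2 v3 \<longleftrightarrow>
     interval E v1 v2 \<inter> interval E v1 v3 = {v1} \<and>
     interval E v2 v1 \<inter> interval E v2 v3 = {v2} \<and>
     interval E v3 v1 \<inter> interval E v3 v2 = {v3}"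

definition grid_dist :: "nat \<times> nat \<Rightarrow> nat \<times> nat \<Rightarrow> nat" where
  "grid_dist p q = nat \<bar>int (fst p) - int (fst q)\<bar> + nat \<bar>int (snd p) - int (snd q)\<bar>"

definition has_isometric_grid :: "('a \<Rightarrow> 'a \<Rightarrow> bool) \<Rightarrow> nat \<Rightarrow> bool" where
  "has_isometric_grid E k \<longleftrightarrow> (\<exists>f :: nat \<times> nat \<Rightarrow> 'a.
     (\<forall>p \<in> {0..k} \<times> {0..k}. \<forall>q \<in> {0..k} \<times> {0..k}.
        (grid_dist p q = 1 \<longrightarrow> E (f p) (f q)) \<and> gdist E (f p) (f q) = grid_dist p q))"

end

theory Submission
  imports Defs
begin

text \<open>In a weakly modular graph the vertices of the side \<open>I(v,w)\<close> of a metric triangle \<open>u v w\<close> are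
all equidistant from \<open>u\<close>.  Testing the four-point condition on \<open>u\<close>, \<open>v\<close>, \<open>w\<close> and a midpoint of that
side bounds the sides in terms of \<open>\<delta>\<close>; the corners of a square grid bound its side.

Conversely, replacing a triple of vertices by a quasi-median shows that the Gromov product
\<open>(x|y)\<close> based at \<open>w\<close> is, up to \<open>\<mu>\<close>, the distance from \<open>w\<close> to some \<open>p \<in> I(w,x) \<inter> I(w,y)\<close>.
If \<open>x, y \<in> I(u,v)\<close> are far apart and at the same distance from \<open>u\<close>, this provides two long geodesics
leaving \<open>x\<close>, both towards \<open>y\<close>, one also towards \<open>u\<close> and the other also towards \<open>v\<close>.  The
quadrangle condition with respect to \<open>y\<close> fills them in to a square grid, which is isometric because
the distances to \<open>u\<close> and to \<open>y\<close> are \<open>const - i + j\<close> and \<open>const - i - j\<close> at position \<open>(i,j)\<close>.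
So intervals are thin, and the four-point condition follows by comparing the points
\<open>p\<close> for \<open>x, z\<close> and for \<open>z, y\<close> inside \<open>I(w,z)\<close>.\<close>

section \<open>Distances in connected graphs\<close>

locale conn_graph =
  fixes E :: "'a \<Rightarrow> 'a \<Rightarrow> bool"
  assumes graph: "is_graph E" and conn: "connected_graph E"
begin

abbreviation d :: "'a \<Rightarrow> 'a \<Rightarrow> nat" where "d \<equiv> gdist E"

lemma E_sym: "E x y \<Longrightarrow> E y x"
  using graph by (simp add: is_graph_def)

lemma walk_shortest: "\<exists>p. is_walk E p (d u v) u v"
  unfolding gdist_def by (rule LeastI_ex) (use conn in \<open>unfold connected_graph_def, blast\<close>)

lemma d_le_walk: "is_walk E p n u v \<Longrightarrow> d u v \<le> n"
  unfolding gdist_def by (blast intro: Least_le)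

lemma is_walk_rev:
  assumes "is_walk E p n u v"
  shows "is_walk E (\<lambda>i. p (n - i)) n v u"
  unfolding is_walk_def
proof (intro conjI allI impI)
  fix i assume i: "i < n"
  then have "E (p (n - Suc i)) (p (Suc (n - Suc i)))"
    using assms unfolding is_walk_def by auto
  then show "E (p (n - i)) (p (n - Suc i))"
    using i E_sym by (simp add: Suc_diff_Suc)
qed (use assms in \<open>auto simp: is_walk_def\<close>)

lemma is_walk_append:
  assumes p: "is_walk E p m u v" and q: "is_walk E q n v w"
  shows "is_walk E (\<lambda>i. if i \<le> m then p i else q (i - m)) (m + n) u w"
  unfolding is_walk_def
proof (intro conjI allI impI)
  show "(if m + n \<le> m then p (m + n) else q (m + n - m)) = w"
    using p q unfolding is_walk_def by auto
next
  fix i assume i: "i < m + n"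
  consider "i < m" | "i = m" | "i > m" by linarith
  then show "E (if i \<le> m then p i else q (i - m)) (if Suc i \<le> m then p (Suc i) else q (Suc i - m))"
  proof cases
    case 2
    then have "E (q 0) (q (Suc 0))" using i q unfolding is_walk_def by auto
    then show ?thesis using 2 p q unfolding is_walk_def by auto
  next
    case 3
    then have "E (q (i - m)) (q (Suc (i - m)))" using i q unfolding is_walk_def by auto
    then show ?thesis using 3 by (simp add: Suc_diff_le)
  qed (use p in \<open>auto simp: is_walk_def\<close>)
qed (use p in \<open>auto simp: is_walk_def\<close>)

lemma d_sym: "d x y = d y x"
  by (meson antisym d_le_walk is_walk_rev walk_shortest)

lemma d_triangle: "d x z \<le> d x y + d y z"
  by (meson d_le_walk is_walk_append walk_shortest)

lemma d_eq_0_iff [simp]: "d x y = 0 \<longleftrightarrow> x = y"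
proof
  assume "d x y = 0"
  then show "x = y" using walk_shortest[of x y] by (auto simp: is_walk_def)
next
  assume "x = y"
  then have "is_walk E (\<lambda>_. x) 0 x y" by (simp add: is_walk_def)
  then show "d x y = 0" using d_le_walk by force
qed

lemma d_self: "d x x = 0"
  by simp

lemma d_eq_1_iff: "d x y = 1 \<longleftrightarrow> E x y"
proof
  assume "d x y = 1"
  then show "E x y" using walk_shortest[of x y] by (auto simp: is_walk_def)
next
  assume E: "E x y"
  then have "is_walk E (\<lambda>i. if i = 0 then x else y) 1 x y" by (simp add: is_walk_def)
  then have "d x y \<le> 1" by (rule d_le_walk)
  moreover have "x \<noteq> y" using E graph by (auto simp: is_graph_def)
  ultimately show "d x y = 1" using d_eq_0_iff[of x y] by linarith
qed

section \<open>Geodesics and quasi-medians\<close>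

lemma geodesic:
  obtains p where "p 0 = x" "p (d x y) = y"
    "\<And>i. i \<le> d x y \<Longrightarrow> d x (p i) = i \<and> d (p i) y = d x y - i"
    "\<And>i. i < d x y \<Longrightarrow> d (p i) (p (Suc i)) = 1"
proof -
  obtain p where p: "is_walk E p (d x y) x y" using walk_shortest by blast
  have "d x (p i) = i \<and> d (p i) y = d x y - i" if i: "i \<le> d x y" for i
  proof -
    have "is_walk E p i x (p i)" using p i by (auto simp: is_walk_def)
    moreover have "is_walk E (\<lambda>j. p (i + j)) (d x y - i) (p i) y"
      using p i by (auto simp: is_walk_def)
    ultimately show ?thesis
      using d_le_walk[of p i x "p i"] d_le_walk[of "\<lambda>j. p (i + j)" "d x y - i" "p i" y]
        d_triangle[of x y "p i"] i by linarith
  qed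
  then show ?thesis using p that[of p] by (auto simp: is_walk_def d_eq_1_iff simp del: One_nat_def)
qed

lemma between_at:
  assumes "m \<le> d x y"
  obtains z where "d x z = m" "d x z + d z y = d x y"
proof (rule geodesic[of x y])
  fix p assume "\<And>i. i \<le> d x y \<Longrightarrow> d x (p i) = i \<and> d (p i) y = d x y - i"
  then show ?thesis using assms that[of "p m"] by auto
qed

text \<open>Take \<open>t\<close> in both intervals from \<open>a\<close> as far from
  \<open>a\<close> as possible; such a point exists because these distances are bounded by
  \<open>d a b\<close>. Any \<open>s\<close> beyond \<open>t\<close> towards both \<open>b\<close>
  and \<open>c\<close> lies in the same two intervals, so by maximality it cannot lie strictly
  beyond \<open>t\<close>.\<close>

lemma farthest_between:
  obtains t where "d a t + d t b = d a b" "d a t + d t c = d a c"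
    "\<And>s. d t s + d s b = d t b \<Longrightarrow> d t s + d s c = d t c \<Longrightarrow> s = t"
proof -
  let ?P = "\<lambda>t. d a t + d t b = d a b \<and> d a t + d t c = d a c"
  have "?P a" by (simp add: d_self)
  moreover have "\<forall>t. ?P t \<longrightarrow> d a t < Suc (d a b)" by linarith
  ultimately obtain t where t: "?P t" and max: "\<And>s. ?P s \<Longrightarrow> d a s \<le> d a t"
    using ex_has_greatest_nat[of ?P a "d a" "Suc (d a b)"] by blast
  have "s = t" if "d t s + d s b = d t b" "d t s + d s c = d t c" for s
  proof -
    have "?P s"
      using that t d_triangle[of a s t] d_triangle[of a b s] d_triangle[of a c s] by linarith
    then have "d a s \<le> d a t" by (rule max)
    then have "d t s = 0"
      using that t d_triangle[of a b s] \<open>?P s\<close> by linarith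
    then show ?thesis by simp
  qed
  then show ?thesis using t that by blast
qed

text \<open>The corners are chosen one after the other, each as far as possible from its own vertex
  and relative to the corners already found. Replacing \<open>y\<close> by \<open>y'\<close> and
  \<open>z\<close> by \<open>z'\<close> only shrinks the intervals that leave the earlier corners,
  so their maximality survives.\<close>

lemma quasi_median:
  obtains x' y' z' where "metric_triangle E x' y' z'"
    "d x x' + d x' y' + d y' y = d x y"
    "d x x' + d x' z' + d z' z = d x z"
    "d y y' + d y' z' + d z' z = d y z"
proof -
  obtain x' where x': "d x x' + d x' y = d x y" "d x x' + d x' z = d x z"
    and x'_max: "\<And>s. d x' s + d s y = d x' y \<Longrightarrow> d x' s + d s z = d x' z \<Longrightarrow> s = x'"
    by (rule farthest_between[of x y z]) blast
  obtain y' where y': "d y y' + d y' x' = d y x'" "d y y' + d y' z = d y z"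
    and y'_max: "\<And>s. d y' s + d s x' = d y' x' \<Longrightarrow> d y' s + d s z = d y' z \<Longrightarrow> s = y'"
    by (rule farthest_between[of y x' z]) blast
  obtain z' where z': "d z z' + d z' x' = d z x'" "d z z' + d z' y' = d z y'"
    and z'_max: "\<And>s. d z' s + d s x' = d z' x' \<Longrightarrow> d z' s + d s y' = d z' y' \<Longrightarrow> s = z'"
    by (rule farthest_between[of z x' y']) blast
  have "s = x'" if "d x' s + d s y' = d x' y'" "d x' s + d s z' = d x' z'" for s
    using that d_triangle[of s y y'] d_triangle[of s z z'] d_triangle[of x' y s] d_triangle[of x' z s]
      y' z' x'_max[of s] d_sym[of z z'] d_sym[of z' x'] d_sym[of z x']
      d_sym[of y y'] d_sym[of y' x'] d_sym[of y x'] by linarith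
  moreover have "s = y'" if "d y' s + d s x' = d y' x'" "d y' s + d s z' = d y' z'" for s
    using that d_triangle[of s z z'] d_triangle[of y' z s] z' y'_max[of s]
      d_sym[of z z'] d_sym[of z' y'] d_sym[of z y'] by linarith
  moreover have "s = z'" if "d z' s + d s x' = d z' x'" "d z' s + d s y' = d z' y'" for s
    using that z'_max by blast
  ultimately have "metric_triangle E x' y' z'"
    unfolding metric_triangle_def interval_def by (auto simp: d_self)
  moreover have "d x x' + d x' y' + d y' y = d x y" "d x x' + d x' z' + d z' z = d x z"
    "d y y' + d y' z' + d z' z = d y z"
    using x' y' z' d_sym[of z z'] d_sym[of z' x'] d_sym[of z x'] d_sym[of z' y'] d_sym[of z y']
      d_sym[of y y'] d_sym[of y' x'] d_sym[of y x'] by linarith+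
  ultimately show ?thesis using that by blast
qed

text \<open>\<open>p\<close> is the corner belonging to \<open>w\<close> in a quasi-median of
  \<open>w\<close>, \<open>x\<close>, \<open>y\<close>; the two sides of the metric triangle at
  \<open>p\<close> account for the error \<open>2 * \<mu>\<close>. The opposite bound is the
  triangle inequality through \<open>p\<close>, so \<open>d w p\<close> is the Gromov product up to
  \<open>\<mu>\<close>.\<close>

lemma gromov_product_attained:
  assumes "\<And>v1 v2 v3. metric_triangle E v1 v2 v3 \<Longrightarrow>
      d v1 v2 \<le> \<mu> \<and> d v2 v3 \<le> \<mu> \<and> d v1 v3 \<le> \<mu>"
  obtains p where "d w p + d p x = d w x" "d w p + d p y = d w y"
    "d w x + d w y \<le> d x y + 2 * d w p + 2 * \<mu>"
proof -
  obtain p x' y' where *: "metric_triangle E p x' y'"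
    "d w p + d p x' + d x' x = d w x" "d w p + d p y' + d y' y = d w y"
    "d x x' + d x' y' + d y' y = d x y"
    by (rule quasi_median[of w x y])
  have mu: "d p x' \<le> \<mu>" "d p y' \<le> \<mu>" using assms[OF *(1)] by auto
  show ?thesis
    using that[of p] * mu d_triangle[of p x x'] d_triangle[of p y y'] d_triangle[of w x p]
      d_triangle[of w y p] d_sym[of x x'] by linarith
qed

section \<open>Upper bound for distances in a grid\<close>

lemma d_le_grid_dist:
  assumes step: "\<And>i j. i < k \<Longrightarrow> j \<le> k \<Longrightarrow> d (F (i, j)) (F (Suc i, j)) = 1"
      "\<And>i j. i \<le> k \<Longrightarrow> j < k \<Longrightarrow> d (F (i, j)) (F (i, Suc j)) = 1"
    and "i \<le> k" "j \<le> k" "i' \<le> k" "j' \<le> k"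
  shows "d (F (i, j)) (F (i', j')) \<le> grid_dist (i, j) (i', j')"
proof -
  have row: "d (F (a, j)) (F (a + n, j)) \<le> n" if "a + n \<le> k" "j \<le> k" for a n j
    using that
  proof (induction n)
    case (Suc n)
    then show ?case
      using step(1)[of "a + n" j] d_triangle[of "F (a, j)" "F (a + Suc n, j)" "F (a + n, j)"] by auto
  qed (simp add: d_self)
  have col: "d (F (i, b)) (F (i, b + n)) \<le> n" if "b + n \<le> k" "i \<le> k" for b n i
    using that
  proof (induction n)
    case (Suc n)
    then show ?case
      using step(2)[of i "b + n"] d_triangle[of "F (i, b)" "F (i, b + Suc n)" "F (i, b + n)"] by auto
  qed (simp add: d_self)
  have "d (F (i, j)) (F (i', j)) \<le> nat \<bar>int i - int i'\<bar>"
  proof (cases "i \<le> i'")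
    case True
    then show ?thesis using row[of i "i' - i" j] assms by simp
  next
    case False
    then show ?thesis using row[of i' "i - i'" j] assms d_sym[of "F (i, j)" "F (i', j)"] by simp
  qed
  moreover have "d (F (i', j)) (F (i', j')) \<le> nat \<bar>int j - int j'\<bar>"
  proof (cases "j \<le> j'")
    case True
    then show ?thesis using col[of j "j' - j" i'] assms by simp
  next
    case False
    then show ?thesis using col[of j' "j - j'" i'] assms d_sym[of "F (i', j)" "F (i', j')"] by simp
  qed
  ultimately show ?thesis
    using d_triangle[of "F (i, j)" "F (i', j')" "F (i', j)"] unfolding grid_dist_def by simp
qed

section \<open>The four-point condition\<close>

lemma sorted3_gap_iff:
  fixes a b c t :: real
  shows "(let s = sort [a, b, c] in s ! 2 - s ! 1 \<le> t) \<longleftrightarrow>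
    a \<le> max b c + t \<and> b \<le> max a c + t \<and> c \<le> max a b + t"
  \<comment> \<open>The inequality for the largest sum is the gap condition itself; it forces
    \<open>t\<close> to be nonnegative, and then the other two inequalities follow.\<close>
  by (auto simp: Let_def numeral_2_eq_2 max_def)

lemma hyperbolicI:
  assumes "\<And>w x y z. d x y + d w z \<le> max (d x z + d w y) (d y z + d w x) + N"
  shows "hyperbolic E (real N / 2)"
  unfolding hyperbolic_def sorted3_gap_iff
proof (intro allI conjI)
  fix u v x y
  have 1: "d u v + d x y \<le> max (d u x + d v y) (d u y + d v x) + N"
    using assms[of u v x y] d_sym[of x v] d_sym[of x u] by (simp add: max_def split: if_splits)
  have 2: "d u x + d v y \<le> max (d u v + d x y) (d u y + d v x) + N"
    using assms[of u x v y] d_sym[of x v] d_sym[of v u] by (simp add: max_def split: if_splits)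
  have 3: "d u y + d v x \<le> max (d u v + d x y) (d u x + d v y) + N"
    using assms[of u y v x] d_sym[of y v] d_sym[of v u] d_sym[of x y]
    by (simp add: max_def split: if_splits)
  show "real (d u v + d x y) \<le> max (real (d u x + d v y)) (real (d u y + d v x)) + 2 * (real N / 2)"
    "real (d u x + d v y) \<le> max (real (d u v + d x y)) (real (d u y + d v x)) + 2 * (real N / 2)"
    "real (d u y + d v x) \<le> max (real (d u v + d x y)) (real (d u x + d v y)) + 2 * (real N / 2)"
    using 1 2 3 by (simp_all add: max_def split: if_splits)
qed

lemma hyperbolicD:
  assumes "hyperbolic E \<delta>"
  shows "real (d u v + d x y) \<le> max (real (d u x + d v y)) (real (d u y + d v x)) + 2 * \<delta>"
  using assms unfolding hyperbolic_def sorted3_gap_iff by blast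

text \<open>This is the inequality "Gromov product of \<open>x\<close>, \<open>y\<close> is at least
  the minimum of those of \<open>x\<close>, \<open>z\<close> and \<open>z\<close>, \<open>y\<close>,
  up to a constant". The points \<open>p\<close> and \<open>q\<close> are pulled back towards
  \<open>w\<close> to the common height \<open>m\<close>; both results lie in \<open>I(w,z)\<close>,
  hence are \<open>\<nu>\<close>-close, and the path from \<open>x\<close> to \<open>y\<close>
  through them is short. Which of \<open>d w p\<close>, \<open>d w q\<close> equals \<open>m\<close>
  decides which term of the maximum is used.\<close>

lemma four_point_of_thin_intervals:
  assumes tri: "\<And>v1 v2 v3. metric_triangle E v1 v2 v3 \<Longrightarrow>
      d v1 v2 \<le> \<mu> \<and> d v2 v3 \<le> \<mu> \<and> d v1 v3 \<le> \<mu>"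
    and thin: "\<And>u v x y. d u x + d x v = d u v \<Longrightarrow> d u y + d y v = d u v \<Longrightarrow> d u x = d u y \<Longrightarrow>
      d x y \<le> \<nu>"
  shows "d x y + d w z \<le> max (d x z + d w y) (d y z + d w x) + (\<nu> + 2 * \<mu>)"
proof -
  obtain p where p: "d w p + d p x = d w x" "d w p + d p z = d w z"
    "d w x + d w z \<le> d x z + 2 * d w p + 2 * \<mu>"
    using gromov_product_attained[OF tri, where w = w and x = x and y = z] by blast
  obtain q where q: "d w q + d q y = d w y" "d w q + d q z = d w z"
    "d w y + d w z \<le> d y z + 2 * d w q + 2 * \<mu>"
    using gromov_product_attained[OF tri, where w = w and x = y and y = z] by blast
  define m where "m = min (d w p) (d w q)"
  obtain p' where p': "d w p' = m" "d w p' + d p' p = d w p"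
    using between_at[of m w p] m_def by auto
  obtain q' where q': "d w q' = m" "d w q' + d q' q = d w q"
    using between_at[of m w q] m_def by auto
  have p'b: "d w p' + d p' x = d w x" "d w p' + d p' z = d w z"
    using p p' d_triangle[of w x p'] d_triangle[of w z p'] d_triangle[of p' x p]
      d_triangle[of p' z p] by linarith+
  have q'b: "d w q' + d q' y = d w y" "d w q' + d q' z = d w z"
    using q q' d_triangle[of w y q'] d_triangle[of w z q'] d_triangle[of q' y q]
      d_triangle[of q' z q] by linarith+
  have "d p' q' \<le> \<nu>"
    using thin[of w p' z q'] p' q' p'b q'b by simp
  then have "d x y + 2 * m \<le> d w x + d w y + \<nu>"
    using p'b q'b p'(1) q'(1) d_triangle[of x y p'] d_triangle[of p' y q'] d_sym[of x p']
    by linarith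
  then show ?thesis
    using p(3) q(3) unfolding m_def by (simp add: max_def min_def split: if_splits)
qed

end

section \<open>Metric triangles in weakly modular graphs\<close>

locale wm_graph = conn_graph +
  assumes wm: "weakly_modular E"
begin

text \<open>Extends the triangle condition to distance 1, where \<open>u\<close> itself is the
  common neighbor; distance 0 would force \<open>v = w\<close>. The quadrangle condition is extended
  in the same way in \<open>QC\<close>.\<close>

lemma TC:
  assumes "d v w = 1" "d u v = d u w"
  obtains x where "d x v = 1" "d x w = 1" "d u x + 1 = d u v"
proof (cases "1 < d u v")
  case True
  then obtain x where "d x v = 1" "d x w = 1" "d u x = d u v - 1"
    using wm assms unfolding weakly_modular_def triangle_condition_def by meson
  then show ?thesis using that True by simp
next
  case False
  have "d u v \<noteq> 0" using assms by (metis d_eq_0_iff zero_neq_one)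
  then show ?thesis using False assms that[of u] d_self[of u] by linarith
qed

lemma QC:
  assumes "d v z = 1" "d w z = 1" "d v w = 2" "d u v = d u w" "d u z = d u v + 1"
  obtains x where "d x v = 1" "d x w = 1" "d u x + 1 = d u v"
proof (cases "2 \<le> d u v")
  case True
  then obtain x where "d x v = 1" "d x w = 1" "d u x = d u v - 1"
    using wm assms unfolding weakly_modular_def quadrangle_condition_def by meson
  then show ?thesis using that True by simp
next
  case False
  have "d u v \<noteq> 0" using assms by (metis d_eq_0_iff zero_neq_numeral)
  then show ?thesis using False assms that[of u] d_self[of u] by linarith
qed

text \<open>The local form of \<open>I(v,u) \<inter> I(v,w) = {v}\<close>.\<close>

definition apex :: "'a \<Rightarrow> 'a \<Rightarrow> 'a \<Rightarrow> bool" where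
  "apex u v w \<longleftrightarrow> \<not> (\<exists>x. d v x = 1 \<and> d u x + 1 = d u v \<and> d w x + 1 = d w v)"

lemma apexD: "apex u v w \<Longrightarrow> d v x = 1 \<Longrightarrow> d u x < d u v \<Longrightarrow> d w x < d w v \<Longrightarrow> False"
  using d_triangle[of u v x] d_triangle[of w v x] d_sym[of x v] unfolding apex_def
  by (metis Suc_eq_plus1 le_antisym less_eq_Suc_le)

text \<open>A step from \<open>w\<close> that approaches \<open>x\<close> also approaches
  \<open>v\<close>, since \<open>x\<close> lies between \<open>v\<close> and
  \<open>w\<close>.\<close>

lemma apex_between:
  assumes "apex u w v" "d v x + d x w = d v w"
  shows "apex u w x"
  unfolding apex_def
proof (rule notI, elim exE conjE)
  fix z assume "d w z = 1" "d u z + 1 = d u w" "d x z + 1 = d x w"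
  then show False
    using apexD[OF assms(1), of z] assms(2) d_triangle[of v z x] by linarith
qed

lemma apex_of_interval:
  assumes "interval E v u \<inter> interval E v w = {v}"
  shows "apex u v w"
  unfolding apex_def
proof (rule notI, elim exE conjE)
  fix x assume *: "d v x = 1" "d u x + 1 = d u v" "d w x + 1 = d w v"
  then have "x \<in> interval E v u \<inter> interval E v w"
    using d_sym[of u x] d_sym[of u v] d_sym[of w x] d_sym[of w v] unfolding interval_def by simp
  then have "x = v" using assms by blast
  then show False using * by simp
qed

text \<open>A step \<open>x'\<close> from \<open>x\<close> towards both \<open>u\<close> and
  \<open>w\<close> is pulled back to such a step from \<open>v\<close>: \<open>TC\<close> and
  \<open>QC\<close> with respect to \<open>u\<close> produce \<open>s\<close> below the edge
  \<open>v x\<close> and \<open>y\<close> below \<open>s\<close> and \<open>x'\<close>, and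
  \<open>TC\<close> with respect to \<open>v\<close> then closes the figure.\<close>

lemma apex_next:
  assumes apex: "apex u v w" and x: "d v x = 1" "d u x = d u v" "d w x + 1 = d w v"
  shows "apex u x w"
  unfolding apex_def
proof (rule notI, elim exE conjE)
  fix x' assume x': "d x x' = 1" "d u x' + 1 = d u x" "d w x' + 1 = d w x"
  have vx': "d v x' = 2"
    using x x' d_triangle[of v x' x] d_triangle[of w v x'] d_sym[of x' v] by linarith
  obtain s where s: "d s v = 1" "d s x = 1" "d u s + 1 = d u v"
    using TC[of v x u] x by auto
  have "\<not> d w s < d w v" using apexD[OF apex, of s] s d_sym[of s v] by auto
  then have ws: "d w s = d w v"
    using d_triangle[of w s x] x s d_sym[of x s] by linarith
  have "d s x' = 2"
    using d_triangle[of s x' x] s x x' d_triangle[of w s x'] d_sym[of x' s] ws by linarith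
  then obtain y where y: "d y s = 1" "d y x' = 1" "d u y + 1 = d u s"
    using QC[of s x x' u] s x x' d_sym[of x' x] by auto
  have vy: "d v y = 2"
    using d_triangle[of v y s] s y d_sym[of y s] d_sym[of s v] d_triangle[of u v y] d_sym[of y v]
    by linarith
  \<comment> \<open>\<open>y\<close> is two steps nearer to \<open>u\<close> than \<open>v\<close>
    is, and \<open>x'\<close> two steps nearer to \<open>w\<close>. A neighbor of \<open>v\<close>
    adjacent to both is therefore nearer to \<open>u\<close> and to \<open>w\<close>.\<close>
  obtain t where t: "d t y = 1" "d t x' = 1" "d v t + 1 = 2"
    using TC[of y x' v] vy vx' y by auto
  show False
    using apexD[OF apex, of t] t y s x' x d_triangle[of u t y] d_triangle[of w t x']
      d_sym[of t y] d_sym[of t x'] by linarith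
qed

text \<open>Induction along the side: the first step from \<open>v\<close> towards \<open>w\<close>
  cannot descend towards \<open>u\<close> because \<open>v\<close> is an apex, and cannot ascend by
  \<open>no_ascent\<close>. So it is level, \<open>apex_next\<close> makes its end an apex again,
  and the induction hypothesis covers the rest of the side.\<close>

lemma side_equidistant:
  assumes "apex u v w" "apex u w v" "d v x + d x w = d v w"
  shows "d u x = d u v"
  using assms
proof (induction "d v w" arbitrary: v x)
  case 0
  then have "d v x = 0" by linarith
  then show ?case by simp
next
  case (Suc n v)
  have vw: "d v w = Suc n" "d w v = Suc n" using Suc.hyps(2) d_sym[of w v] by auto
  note apex = Suc.prems(1)
  have next_apex: "d u y = d u x" if "d v x = 1" "d w x + 1 = d w v" "apex u x w"
    "d x y + d y w = d x w" for x y
  proof -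
    have "apex u w x" using apex_between[OF Suc.prems(2), of x] that vw d_sym[of w x] by simp
    then show ?thesis using Suc.hyps(1)[of x y] that vw d_sym[of w x] by simp
  qed
  have level: "d u y = d u v" if "d v x = 1" "d w x + 1 = d w v" "d u x = d u v"
    "d x y + d y w = d x w" for x y
    using next_apex[of x y] apex_next[OF apex] that by simp
  \<comment> \<open>An ascending \<open>x\<close> would be an apex too, so by induction the whole of
    \<open>I(x,w)\<close>, including \<open>w\<close>, lies at distance \<open>d u v + 1\<close>
    from \<open>u\<close>. The contradiction is a level first step \<open>t\<close>, which puts
    \<open>w\<close> at distance \<open>d u v\<close>.\<close>
  have no_ascent: False if x: "d v x = 1" "d w x + 1 = d w v" and up: "d u x = d u v + 1" for x
  proof -
    have "apex u x w"
      unfolding apex_def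
    proof (rule notI, elim exE conjE)
      fix x' assume x': "d x x' = 1" "d u x' + 1 = d u x" "d w x' + 1 = d w x"
      have "d v x' = 2"
        using x x' d_triangle[of v x' x] d_triangle[of w v x'] d_sym[of x' v] by linarith
      then obtain y where y: "d y v = 1" "d y x' = 1" "d u y + 1 = d u v"
        using QC[of v x x' u] x up x' d_sym[of x' x] by auto
      show False
        using apexD[OF apex, of y] y x x' d_sym[of y v] d_triangle[of w y x'] d_sym[of y x']
        by linarith
    qed
    note const = next_apex[OF x this]
    have uw: "d u w = d u v + 1" using const[of w] up by (simp add: d_self)
    then have "n \<noteq> 0"
      using apexD[OF Suc.prems(2), of v] vw d_self[of v] by auto
    then obtain x2 where x2: "d x x2 = 1" "d x x2 + d x2 w = d x w"
      using between_at[of 1 x w] x vw d_sym[of x w] by auto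
    obtain y where y: "d y x = 1" "d y x2 = 1" "d u y + 1 = d u x"
      using TC[of x x2 u] x2 const[of x2] by auto
    have wy: "d w y \<le> d w x"
      using d_triangle[of w y x2] y x2 d_sym[of y x2] d_sym[of w x2] d_sym[of w x] by linarith
    have vy_cases: "d v y = 1 \<or> d v y = 2"
      using wy x d_triangle[of v y x] y d_sym[of y x] d_triangle[of w v y] d_sym[of y v] by linarith
    \<comment> \<open>If \<open>y\<close>, the vertex below the edge \<open>x x2\<close>, is
      adjacent to \<open>v\<close>, it is the level step itself. Otherwise \<open>QC\<close> gives
      \<open>z\<close> below \<open>v\<close> and \<open>y\<close>; since \<open>v\<close> is an
      apex, \<open>z\<close> is as far from \<open>w\<close> as \<open>v\<close>, and
      \<open>TC\<close> with respect to \<open>w\<close> on the edge \<open>v z\<close> gives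
      \<open>t\<close>.\<close>
    have "\<exists>t. d v t = 1 \<and> d w t + 1 = d w v \<and> d u t = d u v"
    proof (cases "d v y = 1")
      case True
      then show ?thesis
        using wy x y up d_triangle[of w v y] d_sym[of y v] by (intro exI[of _ y]) linarith
    next
      case False
      with vy_cases have "d v y = 2" by simp
      then obtain z where z: "d z v = 1" "d z y = 1" "d u z + 1 = d u v"
        using QC[of v x y u] x y up by auto
      have "\<not> d w z < d w v" using apexD[OF apex, of z] z d_sym[of z v] by auto
      then have "d w z = d w v"
        using wy x d_triangle[of w z y] z d_sym[of z y] by linarith
      then obtain t where t: "d t v = 1" "d t z = 1" "d w t + 1 = d w v"
        using TC[of v z w] z d_sym[of z v] by auto
      have "\<not> d u t < d u v" using apexD[OF apex, of t] t d_sym[of t v] by auto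
      then show ?thesis
        using t z d_triangle[of u t z] d_sym[of t z] d_sym[of t v] by (intro exI[of _ t]) linarith
    qed
    then show False using level[of _ w] uw by (auto simp: d_self)
  qed
  show ?case
  proof (cases "x = v")
    case False
    then have "d v x \<noteq> 0" by auto
    then have "1 \<le> d v x" by linarith
    then obtain y where y: "d v y = 1" "d v y + d y x = d v x"
      by (rule between_at)
    have yw: "d w y + 1 = d w v" "d y x + d x w = d y w"
      using y Suc.prems(3) d_triangle[of v w y] d_triangle[of y w x] d_sym[of w y] d_sym[of w v]
      by linarith+
    have "\<not> d u y < d u v" using apexD[OF apex, of y] y yw by auto
    moreover have "d u y \<noteq> d u v + 1" using no_ascent[of y] y yw by blast
    ultimately have "d u y = d u v" using d_triangle[of u y v] y by linarith
    then show ?thesis using level[of y x] y yw by simp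
  qed simp
qed

lemma metric_triangle_equidistant:
  assumes "metric_triangle E u v w" "d v x + d x w = d v w"
  shows "d u x = d u v"
  using side_equidistant[of u v w x] assms apex_of_interval[of v u w] apex_of_interval[of w u v]
  unfolding metric_triangle_def by (auto simp: Int_commute)

lemma metric_triangle_rotate: "metric_triangle E u v w \<Longrightarrow> metric_triangle E v w u"
  unfolding metric_triangle_def by (simp add: Int_commute)

text \<open>Equidistance makes the triangle equilateral, with side n say. For the corners and a
  midpoint \<open>x\<close> of the side opposite \<open>u\<close>, one sum is 2n and the other two
  are at most n plus n/2 rounded up; the rounding causes the \<open>+ 1\<close>.\<close>

lemma hyperbolic_metric_triangle:
  assumes hyp: "hyperbolic E \<delta>" and tri: "metric_triangle E u v w"
  shows "d u v = d v w \<and> d u w = d v w \<and> real (d v w) \<le> 4 * \<delta> + 1"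
proof -
  have uw: "d u w = d u v" using metric_triangle_equidistant[OF tri, of w] by (simp add: d_self)
  have vu: "d v u = d v w"
    using metric_triangle_equidistant[OF metric_triangle_rotate[OF tri], of u] by (simp add: d_self)
  obtain x where x: "d v x = d v w div 2" "d v x + d x w = d v w"
    by (rule between_at[of "d v w div 2" v w]) auto
  have "d u x = d u v" by (rule metric_triangle_equidistant[OF tri x(2)])
  then show ?thesis
    using uw vu hyperbolicD[OF hyp, of u x v w] x d_sym[of u v] d_sym[of v x]
    by (simp add: max_def split: if_splits)
qed

end

section \<open>Thin intervals and square grids\<close>

text \<open>For the four corners the diagonals sum to \<open>4 * k\<close>, each pair of opposite
  sides to \<open>2 * k\<close>.\<close>

lemma (in conn_graph) hyperbolic_grid:
  assumes "hyperbolic E \<delta>" "has_isometric_grid E k"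
  shows "real k \<le> \<delta>"
proof -
  obtain F where F: "\<And>p q. p \<in> {0..k} \<times> {0..k} \<Longrightarrow> q \<in> {0..k} \<times> {0..k} \<Longrightarrow>
    d (F p) (F q) = grid_dist p q"
    using assms(2) unfolding has_isometric_grid_def by blast
  show ?thesis
    using hyperbolicD[OF assms(1), of "F (0,0)" "F (k,k)" "F (0,k)" "F (k,0)"]
    by (simp add: F grid_dist_def)
qed

fun grid_fill :: "('a \<Rightarrow> 'a \<Rightarrow> 'a) \<Rightarrow> (nat \<Rightarrow> 'a) \<Rightarrow> (nat \<Rightarrow> 'a) \<Rightarrow> nat \<Rightarrow> nat \<Rightarrow> 'a" where
  "grid_fill g a b i 0 = a i"
| "grid_fill g a b 0 (Suc j) = b (Suc j)"
| "grid_fill g a b (Suc i) (Suc j) = g (grid_fill g a b (Suc i) j) (grid_fill g a b i (Suc j))"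

section \<open>Square grids inside thick intervals\<close>

context wm_graph
begin

text \<open>The vertex supplied by \<open>QC\<close> can be chosen from \<open>v\<close> and
  \<open>w\<close> alone, as its required properties do not mention \<open>z\<close>. This makes it
  a legitimate argument \<open>g\<close> of \<open>grid_fill\<close>.\<close>

lemma QC_choice:
  obtains g where "\<And>v w z. d v z = 1 \<Longrightarrow> d w z = 1 \<Longrightarrow> d v w = 2 \<Longrightarrow> d u v = d u w \<Longrightarrow>
    d u z = d u v + 1 \<Longrightarrow> d (g v w) v = 1 \<and> d (g v w) w = 1 \<and> d u (g v w) + 1 = d u v"
proof -
  have "\<forall>v w. \<exists>x. (\<exists>z. d v z = 1 \<and> d w z = 1 \<and> d v w = 2 \<and> d u v = d u w \<and> d u z = d u v + 1) \<longrightarrow>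
    d x v = 1 \<and> d x w = 1 \<and> d u x + 1 = d u v"
    by (metis QC)
  then obtain g where "\<forall>v w. (\<exists>z. d v z = 1 \<and> d w z = 1 \<and> d v w = 2 \<and> d u v = d u w \<and>
      d u z = d u v + 1) \<longrightarrow> d (g v w) v = 1 \<and> d (g v w) w = 1 \<and> d u (g v w) + 1 = d u v"
    by metis
  then show ?thesis using that[of g] by blast
qed

text \<open>The geodesic to \<open>p\<close> descends towards \<open>u\<close>; the one to
  \<open>q\<close> descends towards \<open>v\<close> and thus moves away from \<open>u\<close>. Both
  descend towards \<open>y\<close>, and \<open>2 * k \<le> d x y\<close> leaves room for the far
  corner, which is \<open>2 * k\<close> levels nearer to \<open>y\<close>.\<close>

lemma isometric_grid_of_corner:
  assumes x: "d u x + d x v = d u v" and xy: "2 * k \<le> d x y"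
    and p: "d x p = k" "d x p + d p y = d x y" "d x p + d p u = d x u"
    and q: "d x q = k" "d x q + d q y = d x y" "d x q + d q v = d x v"
  shows "has_isometric_grid E k"
proof -
  obtain a where a0: "a 0 = x" and a: "\<And>i. i \<le> k \<Longrightarrow> d x (a i) = i \<and> d (a i) p = k - i"
    and a_step: "\<And>i. i < k \<Longrightarrow> d (a i) (a (Suc i)) = 1"
    by (rule geodesic[of x p]) (use p in auto)
  obtain b where b0: "b 0 = x" and b: "\<And>i. i \<le> k \<Longrightarrow> d x (b i) = i \<and> d (b i) q = k - i"
    and b_step: "\<And>i. i < k \<Longrightarrow> d (b i) (b (Suc i)) = 1"
    by (rule geodesic[of x q]) (use q in auto)
  have ay: "d y (a i) + i = d x y" and au: "d u (a i) + i = d u x" if "i \<le> k" for i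
    using a[OF that] that p d_triangle[of "a i" y p] d_triangle[of x y "a i"] d_triangle[of "a i" u p]
      d_triangle[of x u "a i"] d_sym[of y "a i"] d_sym[of u "a i"] d_sym[of u x] by linarith+
  have b_y: "d y (b i) + i = d x y" and bu: "d u (b i) = d u x + i" if "i \<le> k" for i
    using b[OF that] that x q d_triangle[of "b i" y q] d_triangle[of x y "b i"] d_triangle[of "b i" v q]
      d_triangle[of x v "b i"] d_sym[of y "b i"] d_triangle[of u "b i" x] d_triangle[of u v "b i"]
    by linarith+
  obtain g where g: "\<And>v w z. d v z = 1 \<Longrightarrow> d w z = 1 \<Longrightarrow> d v w = 2 \<Longrightarrow> d y v = d y w \<Longrightarrow>
    d y z = d y v + 1 \<Longrightarrow> d (g v w) v = 1 \<and> d (g v w) w = 1 \<and> d y (g v w) + 1 = d y v"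
    by (rule QC_choice[of y]) blast
  define f where "f = grid_fill g a b"
  have f0: "f i 0 = a i" "f 0 j = b j" for i j
    unfolding f_def using a0 b0 by (cases j; simp)+
  have fS: "f (Suc i) (Suc j) = g (f (Suc i) j) (f i (Suc j))" for i j
    unfolding f_def by simp
  have f: "d y (f i j) + i + j = d x y \<and> d u (f i j) + i = d u x + j \<and>
      (0 < i \<longrightarrow> d (f (i - 1) j) (f i j) = 1) \<and> (0 < j \<longrightarrow> d (f i (j - 1)) (f i j) = 1)"
    if "i \<le> k" "j \<le> k" for i j
    using that
  proof (induction "i + j" arbitrary: i j rule: less_induct)
    case less
    consider "j = 0" | "i = 0" | i' j' where "i = Suc i'" "j = Suc j'"
      by (metis not0_implies_Suc)
    then show ?case
    proof cases
      case 1
      then show ?thesis using ay[of i] au[of i] a_step[of "i - 1"] less.prems by (auto simp: f0)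
    next
      case 2
      then show ?thesis using b_y[of j] bu[of j] b_step[of "j - 1"] less.prems by (auto simp: f0)
    next
      case 3
      have le: "i' \<le> k" "Suc i' \<le> k" "j' \<le> k" "Suc j' \<le> k" "Suc i' + Suc j' \<le> d x y"
        using 3 less.prems xy by auto
      have Z: "d y (f i' j') + i' + j' = d x y" "d u (f i' j') + i' = d u x + j'"
        using less.hyps[of i' j'] 3 le by auto
      have V: "d y (f (Suc i') j') + Suc i' + j' = d x y"
        "d u (f (Suc i') j') + Suc i' = d u x + j'" "d (f i' j') (f (Suc i') j') = 1"
        using less.hyps[of "Suc i'" j'] 3 le by auto
      have W: "d y (f i' (Suc j')) + i' + Suc j' = d x y"
        "d u (f i' (Suc j')) + i' = d u x + Suc j'" "d (f i' j') (f i' (Suc j')) = 1"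
        using less.hyps[of i' "Suc j'"] 3 le by auto
      \<comment> \<open>Their distances to \<open>u\<close> differ by 2, so these two neighbors of
        \<open>f i' j'\<close> cannot be closer.\<close>
      have "d (f (Suc i') j') (f i' (Suc j')) = 2"
        using V W d_triangle[of "f (Suc i') j'" "f i' (Suc j')" "f i' j'"]
          d_triangle[of u "f i' (Suc j')" "f (Suc i') j'"] d_sym[of "f i' j'" "f (Suc i') j'"]
        by linarith
      then have G: "d (f i j) (f (Suc i') j') = 1" "d (f i j) (f i' (Suc j')) = 1"
        "d y (f i j) + 1 = d y (f (Suc i') j')"
        using g[of "f (Suc i') j'" "f i' j'" "f i' (Suc j')"] V W Z 3 fS
          d_sym[of "f i' j'" "f (Suc i') j'"] d_sym[of "f i' j'" "f i' (Suc j')"] by auto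
      \<comment> \<open>The new vertex is adjacent to two vertices whose distances to
        \<open>u\<close> differ by 2, so its own distance is the value in between.\<close>
      have "d u (f i j) + i = d u x + j"
        using G V W 3 d_triangle[of u "f i j" "f (Suc i') j'"]
          d_triangle[of u "f i' (Suc j')" "f i j"] d_sym[of "f i j" "f (Suc i') j'"] by linarith
      moreover have "d (f i' j) (f i j) = 1" "d (f i j') (f i j) = 1"
        using G(1,2) d_sym[of "f i j" "f (Suc i') j'"] d_sym[of "f i j" "f i' (Suc j')"]
        unfolding 3 by linarith+
      moreover have "d y (f i j) + i + j = d x y" using G(3) V(1) unfolding 3 by linarith
      moreover have "i - 1 = i'" "j - 1 = j'" using 3 by simp_all
      ultimately show ?thesis by simp
    qed
  qed
  define F where "F = (\<lambda>(i, j). f i j)"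
  have dF: "d (F r) (F s) = grid_dist r s" if rs: "r \<in> {0..k} \<times> {0..k}" "s \<in> {0..k} \<times> {0..k}" for r s
  proof -
    obtain i j i' j' where [simp]: "r = (i, j)" "s = (i', j')" by (cases r; cases s)
    have le: "i \<le> k" "j \<le> k" "i' \<le> k" "j' \<le> k" using rs by auto
    have "d (F (i, j)) (F (i', j')) \<le> grid_dist (i, j) (i', j')"
    proof (rule d_le_grid_dist[OF _ _ le])
      show "d (F (i, j)) (F (Suc i, j)) = 1" if "i < k" "j \<le> k" for i j
        using f[of "Suc i" j] that by (simp add: F_def)
      show "d (F (i, j)) (F (i, Suc j)) = 1" if "i \<le> k" "j < k" for i j
        using f[of i "Suc j"] that by (simp add: F_def)
    qed
    \<comment> \<open>Distances to \<open>y\<close> and to \<open>u\<close> change by at most the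
      distance moved. They bound the changes of \<open>i + j\<close> and of \<open>j - i\<close>,
      and the larger of these two changes in absolute value is the grid distance.\<close>
    moreover have "grid_dist r s \<le> d (f i j) (f i' j')"
    proof -
      have lev: "d y (f i j) + i + j = d x y" "d u (f i j) + i = d u x + j"
        "d y (f i' j') + i' + j' = d x y" "d u (f i' j') + i' = d u x + j'"
        using f le by blast+
      have "i' + j' \<le> i + j + d (f i j) (f i' j')"
        using lev d_triangle[of y "f i j" "f i' j'"] d_sym[of "f i j" "f i' j'"] by linarith
      moreover have "i + j \<le> i' + j' + d (f i j) (f i' j')"
        using lev d_triangle[of y "f i' j'" "f i j"] by linarith
      moreover have "i' + j \<le> i + j' + d (f i j) (f i' j')"
        using lev d_triangle[of u "f i j" "f i' j'"] d_sym[of "f i j" "f i' j'"] by linarith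
      moreover have "i + j' \<le> i' + j + d (f i j) (f i' j')"
        using lev d_triangle[of u "f i' j'" "f i j"] by linarith
      ultimately show ?thesis unfolding grid_dist_def by simp
    qed
    ultimately show ?thesis by (simp add: F_def)
  qed
  then show ?thesis
    unfolding has_isometric_grid_def by (intro exI[of _ F]) (metis d_eq_1_iff)
qed

lemma thin_intervals:
  assumes tri: "\<And>v1 v2 v3. metric_triangle E v1 v2 v3 \<Longrightarrow>
      d v1 v2 \<le> \<mu> \<and> d v2 v3 \<le> \<mu> \<and> d v1 v3 \<le> \<mu>"
    and no_grid: "\<not> has_isometric_grid E k"
    and x: "d u x + d x v = d u v" and y: "d u y + d y v = d u v" and eq: "d u x = d u y"
  shows "d x y \<le> 2 * k + 2 * \<mu>"
proof (rule ccontr)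
  assume far: "\<not> ?thesis"
  \<comment> \<open>For \<open>t\<close> equidistant from \<open>x\<close> and \<open>y\<close>,
    twice the Gromov product of \<open>t\<close> and \<open>y\<close> based at \<open>x\<close> is
    \<open>d x y\<close>, which exceeds \<open>2 * k + 2 * \<mu>\<close>. The point attaining it up
    to \<open>\<mu>\<close> is thus at least \<open>k\<close> away from \<open>x\<close> and can be
    pulled back to distance exactly \<open>k\<close>.\<close>
  have corner: "\<exists>p. d x p = k \<and> d x p + d p y = d x y \<and> d x p + d p t = d x t"
    if t: "d t x = d t y" for t
  proof -
    obtain p where p: "d x p + d p t = d x t" "d x p + d p y = d x y"
      "d x t + d x y \<le> d t y + 2 * d x p + 2 * \<mu>"
      using gromov_product_attained[OF tri, where w = x and x = t and y = y] by blast
    have "k \<le> d x p" using p t far d_sym[of t x] by linarith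
    then obtain p' where p': "d x p' = k" "d x p' + d p' p = d x p" by (rule between_at)
    then show ?thesis
      using p d_triangle[of p' y p] d_triangle[of p' t p] d_triangle[of x y p'] d_triangle[of x t p']
      by (intro exI[of _ p']) linarith
  qed
  obtain p where p: "d x p = k" "d x p + d p y = d x y" "d x p + d p u = d x u"
    using corner[of u] eq by blast
  have "d v x = d v y" using eq x y d_sym[of v x] d_sym[of v y] by linarith
  then obtain q where q: "d x q = k" "d x q + d q y = d x y" "d x q + d q v = d x v"
    using corner[of v] by blast
  have "2 * k \<le> d x y" using far by linarith
  then have "has_isometric_grid E k" using x p q by (intro isometric_grid_of_corner)
  then show False using no_grid by contradiction
qed

end

section \<open>The equivalence, with explicit constants\<close>

theorem theorem9p6:
  fixes E :: "'a \<Rightarrow> 'a \<Rightarrow> bool"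
  assumes "is_graph E" and "connected_graph E" and "weakly_modular E"
  shows "(\<exists>\<delta>::real. hyperbolic E \<delta>) \<longleftrightarrow>
         (\<exists>\<mu> \<kappa> :: nat.
            (\<forall>v1 v2 v3. metric_triangle E v1 v2 v3 \<longrightarrow>
               gdist E v1 v2 \<le> \<mu> \<and> gdist E v2 v3 \<le> \<mu> \<and> gdist E v1 v3 \<le> \<mu>) \<and>
            \<not> has_isometric_grid E \<kappa>)"
proof -
  interpret wm_graph E using assms by unfold_locales
  show ?thesis
  proof
    assume "\<exists>\<delta>::real. hyperbolic E \<delta>"
    then obtain \<delta> where hyp: "hyperbolic E \<delta>" ..
    obtain \<mu> :: nat where \<mu>: "4 * \<delta> + 1 \<le> real \<mu>" using real_arch_simple by blast
    obtain \<kappa> :: nat where \<kappa>: "\<delta> < real \<kappa>" using reals_Archimedean2 by blast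
    have "d v1 v2 \<le> \<mu> \<and> d v2 v3 \<le> \<mu> \<and> d v1 v3 \<le> \<mu>" if "metric_triangle E v1 v2 v3" for v1 v2 v3
      using hyperbolic_metric_triangle[OF hyp that] \<mu> by linarith
    moreover have "\<not> has_isometric_grid E \<kappa>"
      using hyperbolic_grid[OF hyp] \<kappa> by fastforce
    ultimately show "\<exists>\<mu> \<kappa>. (\<forall>v1 v2 v3. metric_triangle E v1 v2 v3 \<longrightarrow>
        d v1 v2 \<le> \<mu> \<and> d v2 v3 \<le> \<mu> \<and> d v1 v3 \<le> \<mu>) \<and> \<not> has_isometric_grid E \<kappa>"
      by blast
  next
    assume "\<exists>\<mu> \<kappa>. (\<forall>v1 v2 v3. metric_triangle E v1 v2 v3 \<longrightarrow>
        d v1 v2 \<le> \<mu> \<and> d v2 v3 \<le> \<mu> \<and> d v1 v3 \<le> \<mu>) \<and> \<not> has_isometric_grid E \<kappa>"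
    then obtain \<mu> \<kappa> where tri: "\<And>v1 v2 v3. metric_triangle E v1 v2 v3 \<Longrightarrow>
        d v1 v2 \<le> \<mu> \<and> d v2 v3 \<le> \<mu> \<and> d v1 v3 \<le> \<mu>" and no_grid: "\<not> has_isometric_grid E \<kappa>"
      by blast
    \<comment> \<open>With \<open>\<nu> = 2 * \<kappa> + 2 * \<mu>\<close> the four-point error is
      \<open>2 * \<kappa> + 4 * \<mu>\<close>, so the resulting constant is
      \<open>\<kappa> + 2 * \<mu>\<close>.\<close>
    show "\<exists>\<delta>. hyperbolic E \<delta>"
      by (rule exI, rule hyperbolicI, rule four_point_of_thin_intervals[OF tri],
          assumption, rule thin_intervals[OF tri no_grid])
  qed
qed

end
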